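(* Let $\rho,\pi\in S_n$. If $LTR(\rho)\subseteq LTR(\pi)$, then $|q^{-1}(\rho)|\le|q^{-1}(\pi)|$.
   Context: $S_n$ is the set of permutations of $\{1,\dots,n\}$ in one-line notation $\pi=\pi_1\cdots\pi_n$. An entry $\pi_i$ is a left-to-right (LTR) maximum if $\pi_i>\pi_j$ for all $j<i$; $LTR(\pi)=\{i\le n:\pi_i\text{ is an LTR maximum of }\pi\}$ is the set of positions of LTR maxima. The map $q:S_n\to S_n$ (the algorithm Queuesort, sorting with a queue allowing bypass): let $m_1,\dots,m_r$ be the LTR maxima of $\pi$ from left to right; for $i=r,\dots,1$ in this order, repeatedly swap $m_i$ with the entry immediately to its right as long as such an entry exists and is smaller than $m_i$; the result is $q(\pi)$. $q^{-1}(\pi)=\{\sigma\in S_n: q(\sigma)=\pi\}$. *)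

theory Defs
  imports "HOL-Combinatorics.Multiset_Permutations"
begin

text \<open>
  A permutation of \<open>{1..n}\<close> is its one-line notation, i.e. an element of
  \<^term>\<open>permutations_of_set {1..n::nat}\<close>. Positions are counted from 1, so the entry
  \<open>\<pi>\<^sub>i\<close> is \<open>\<pi> ! (i - 1)\<close>.
\<close>

definition LTR :: "nat list \<Rightarrow> nat set" where
  "LTR \<pi> = {i \<in> {1..length \<pi>}. \<forall>j\<in>{1..<i}. \<pi> ! (j - 1) < \<pi> ! (i - 1)}"

definition LTR_maxima :: "nat list \<Rightarrow> nat list" where
  "LTR_maxima \<pi> = map (\<lambda>i. \<pi> ! (i - 1)) (sorted_list_of_set (LTR \<pi>))"

text \<open>
  Repeatedly swap the entry \<open>m\<close> with its right neighbour as long as that neighbour exists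
  and is smaller than \<open>m\<close>.
\<close>

fun bubble :: "nat \<Rightarrow> nat list \<Rightarrow> nat list" where
  "bubble m (x # y # ys) =
     (if x = m then (if y < m then y # bubble m (m # ys) else m # y # ys)
      else x # bubble m (y # ys))"
| "bubble m xs = xs"

text \<open>
  \<^const>\<open>foldr\<close> handles the last LTR maximum first; the LTR maxima are those of the input,
  not of the intermediate results.
\<close>

definition queuesort :: "nat list \<Rightarrow> nat list" where
  "queuesort \<pi> = foldr bubble (LTR_maxima \<pi>) \<pi>"

definition queuesort_preimage :: "nat \<Rightarrow> nat list \<Rightarrow> nat list set" where
  "queuesort_preimage n \<pi> = {\<sigma> \<in> permutations_of_set {1..n}. queuesort \<sigma> = \<pi>}"

end

theory Submission
  imports Defs
begin

text \<open>
  Let \<open>q \<sigma> = \<rho>\<close>, and let \<open>f\<close> be the relabelling with \<open>f \<rho>\<^sub>i = \<pi>\<^sub>i\<close>. The queue only ever compares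
  an LTR maximum \<open>m\<close> of \<open>\<sigma>\<close> with entries that end up before \<open>m\<close> in \<open>\<rho>\<close>, or with the entry right
  after \<open>m\<close> in \<open>\<rho>\<close>. Both \<open>m\<close> and this next entry are LTR maxima of \<open>\<rho>\<close>, so their positions belong
  to \<open>LTR \<pi>\<close> and \<open>f\<close> preserves all these comparisons. Hence \<open>q (f \<circ> \<sigma>) = f \<circ> \<rho> = \<pi>\<close>, and
  \<open>\<sigma> \<mapsto> f \<circ> \<sigma>\<close> is an injection of \<open>q\<^sup>-\<^sup>1(\<rho>)\<close> into \<open>q\<^sup>-\<^sup>1(\<pi>)\<close>.
\<close>

section \<open>Bubbling and its invariants\<close>

lemma bubble_append: "m \<notin> set as \<Longrightarrow> bubble m (as @ ys) = as @ bubble m ys"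
proof (induction as)
  case (Cons a as)
  then show ?case by (cases "as @ ys") auto
qed simp

lemma bubble_Cons_same:
  "bubble m (m # xs) = takeWhile (\<lambda>x. x < m) xs @ m # dropWhile (\<lambda>x. x < m) xs"
  by (induction xs) auto

lemma mset_bubble [simp]: "mset (bubble m xs) = mset xs"
  by (induction m xs rule: bubble.induct) auto

lemma mset_queuesort [simp]: "mset (queuesort xs) = mset xs"
proof -
  have "mset (foldr bubble ms xs) = mset xs" for ms by (induction ms) auto
  then show ?thesis by (simp add: queuesort_def)
qed

lemma set_queuesort [simp]: "set (queuesort xs) = set xs"
  by (metis mset_queuesort set_mset_mset)

lemma distinct_queuesort [simp]: "distinct (queuesort xs) \<longleftrightarrow> distinct xs"
  by (metis mset_queuesort mset_eq_imp_distinct_iff)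

lemma foldr_bubble_append:
  "set ms \<inter> set as = {} \<Longrightarrow> foldr bubble ms (as @ ys) = as @ foldr bubble ms ys"
  by (induction ms) (auto simp: bubble_append)

section \<open>Recursive description of the LTR maxima\<close>

lemma finite_LTR [simp]: "finite (LTR xs)"
  by (simp add: LTR_def)

text \<open>Replaces index arithmetic by splittings of the list; with positions counted from 1,
  \<open>m\<close> stands at \<open>Suc (length as)\<close>.\<close>

lemma mem_LTR_append:
  "Suc (length as) \<in> LTR (as @ m # bs) \<longleftrightarrow> (\<forall>y\<in>set as. y < m)"
proof -
  have "(\<forall>j\<in>{1..<Suc (length as)}. (as @ m # bs) ! (j - 1) < m) \<longleftrightarrow> (\<forall>i<length as. as ! i < m)"
    (is "?L = ?R")
  proof
    assume L: ?L
    show ?R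
    proof (intro allI impI)
      fix i assume "i < length as"
      with L[rule_format, of "Suc i"] show "as ! i < m" by (simp add: nth_append)
    qed
  qed (auto simp: nth_append)
  then show ?thesis by (simp add: LTR_def all_set_conv_all_nth nth_append)
qed

text \<open>The block \<open>ps\<close> is hidden behind \<open>m\<close>. Each LTR maximum of
  \<open>rs\<close> is at least \<open>hd rs\<close>, hence above all of \<open>m # ps\<close>, and
  stays one after the shift.\<close>

lemma LTR_Cons_append:
  assumes "\<forall>x\<in>set ps. x < m" and "rs \<noteq> [] \<Longrightarrow> m < hd rs"
  shows "LTR (m # ps @ rs) = insert 1 ((\<lambda>i. i + Suc (length ps)) ` LTR rs)"
proof (intro set_eqI iffI)
  fix i assume i: "i \<in> LTR (m # ps @ rs)"
  then have "1 \<le> i" "i \<le> length (m # ps @ rs)" by (auto simp: LTR_def)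
  define us where "us = take (i - 1) (m # ps @ rs)"
  define v where "v = (m # ps @ rs) ! (i - 1)"
  define ws where "ws = drop i (m # ps @ rs)"
  have split: "m # ps @ rs = us @ v # ws" and len: "i = Suc (length us)"
    using \<open>1 \<le> i\<close> \<open>i \<le> _\<close> id_take_nth_drop[of "i - 1" "m # ps @ rs"]
    by (auto simp: us_def v_def ws_def)
  have max: "\<forall>y\<in>set us. y < v"
    using i unfolding split len mem_LTR_append .
  show "i \<in> insert 1 ((\<lambda>i. i + Suc (length ps)) ` LTR rs)"
  proof (cases us)
    case Nil
    then show ?thesis using len by simp
  next
    case (Cons a us')
    then have "ps @ rs = us' @ v # ws" "m < v" using split max by auto
    \<comment> \<open>Since \<open>m < v\<close>, the entry \<open>v\<close> cannot lie in
      \<open>ps\<close>, so the splitting takes place inside \<open>rs\<close>.\<close>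
    then obtain us'' where "us' = ps @ us''" "rs = us'' @ v # ws"
      using assms(1) by (auto simp: append_eq_append_conv2 append_eq_Cons_conv Cons_eq_append_conv)
    moreover have "Suc (length us'') \<in> LTR rs"
      using max Cons calculation by (simp add: mem_LTR_append)
    ultimately show ?thesis using len Cons by auto
  qed
next
  fix i assume "i \<in> insert 1 ((\<lambda>i. i + Suc (length ps)) ` LTR rs)"
  then consider "i = 1" | j where "j \<in> LTR rs" "i = j + Suc (length ps)" by auto
  then show "i \<in> LTR (m # ps @ rs)"
  proof cases
    case 1
    then show ?thesis using mem_LTR_append[of "[]" m "ps @ rs"] by simp
  next
    case 2
    then have "1 \<le> j" "j \<le> length rs" by (auto simp: LTR_def)
    define us where "us = take (j - 1) rs"
    define v where "v = rs ! (j - 1)"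
    define ws where "ws = drop j rs"
    have split: "rs = us @ v # ws" and len: "j = Suc (length us)"
      using \<open>1 \<le> j\<close> \<open>j \<le> _\<close> id_take_nth_drop[of "j - 1" rs]
      by (auto simp: us_def v_def ws_def)
    have max: "\<forall>y\<in>set us. y < v"
      using 2(1) unfolding split len mem_LTR_append .
    \<comment> \<open>Either \<open>v\<close> is \<open>hd rs\<close>, or \<open>hd rs\<close> lies
      in \<open>us\<close> and is thus below \<open>v\<close>.\<close>
    have "m < v"
      using assms(2) max split by (cases us) auto
    then have "Suc (length (m # ps @ us)) \<in> LTR ((m # ps @ us) @ v # ws)"
      unfolding mem_LTR_append using max assms(1) by auto
    then show ?thesis using 2(2) split len by (simp add: add.commute)
  qed
qed

lemma hd_dropWhile_less:
  fixes m :: "'a :: linorder"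
  assumes "m \<notin> set xs" and "dropWhile (\<lambda>x. x < m) xs \<noteq> []"
  shows "m < hd (dropWhile (\<lambda>x. x < m) xs)"
  using assms by (metis hd_dropWhile hd_in_set linorder_cases set_dropWhileD)

lemma LTR_maxima_Cons:
  assumes "m \<notin> set xs"
  shows "LTR_maxima (m # xs) = m # LTR_maxima (dropWhile (\<lambda>x. x < m) xs)"
proof -
  define ps where "ps = takeWhile (\<lambda>x. x < m) xs"
  define rs where "rs = dropWhile (\<lambda>x. x < m) xs"
  have xs: "xs = ps @ rs" by (simp add: ps_def rs_def)
  let ?g = "\<lambda>i. i + Suc (length ps)"
  have "LTR (m # xs) = insert 1 (?g ` LTR rs)"
    unfolding xs
  proof (rule LTR_Cons_append)
    show "\<forall>x\<in>set ps. x < m" by (auto simp: ps_def dest: set_takeWhileD)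
    show "rs \<noteq> [] \<Longrightarrow> m < hd rs" using hd_dropWhile_less assms by (simp add: rs_def)
  qed
  moreover have "sorted_list_of_set (insert 1 (?g ` LTR rs))
      = 1 # map ?g (sorted_list_of_set (LTR rs))"
  proof -
    let ?L = "1 # map ?g (sorted_list_of_set (LTR rs))"
    \<comment> \<open>Positions in \<open>LTR rs\<close> are at least 1, so the shifted ones differ
      from the leading 1.\<close>
    have "sorted ?L" "distinct ?L"
      by (auto simp: sorted_wrt_map distinct_map inj_on_def LTR_def)
    then have "sorted_list_of_set (set ?L) = ?L"
      by (intro sorted_list_of_set.idem_if_sorted_distinct) auto
    then show ?thesis by simp
  qed
  moreover have "(m # xs) ! (?g i - 1) = rs ! (i - 1)" if "i \<in> LTR rs" for i
    using that by (cases i) (auto simp: LTR_def xs nth_append)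
  ultimately show ?thesis
    by (simp add: LTR_maxima_def flip: rs_def)
qed

section \<open>Recursion for Queuesort\<close>

lemma set_LTR_maxima_subset: "set (LTR_maxima xs) \<subseteq> set xs"
  by (auto simp: LTR_maxima_def LTR_def)

text \<open>The later LTR maxima move first. All of them lie beyond the entries that
  \<open>m\<close> hides, so they sort the remainder behind a fixed prefix, and \<open>m\<close>
  itself moves last.\<close>

lemma queuesort_Cons:
  assumes "distinct (m # xs)"
  shows "queuesort (m # xs) =
    bubble m (m # takeWhile (\<lambda>x. x < m) xs @ queuesort (dropWhile (\<lambda>x. x < m) xs))"
proof -
  define ps where "ps = takeWhile (\<lambda>x. x < m) xs"
  define rs where "rs = dropWhile (\<lambda>x. x < m) xs"
  have xs: "xs = ps @ rs" by (simp add: ps_def rs_def)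
  have "set (LTR_maxima rs) \<inter> set (m # ps) = {}"
    using set_LTR_maxima_subset[of rs] assms xs by auto
  then have "foldr bubble (LTR_maxima rs) ((m # ps) @ rs)
      = (m # ps) @ foldr bubble (LTR_maxima rs) rs"
    by (rule foldr_bubble_append)
  then show ?thesis
    using assms by (simp add: queuesort_def LTR_maxima_Cons flip: ps_def rs_def) (simp add: xs)
qed

section \<open>Comparisons visible in the output\<close>

text \<open>
  The comparisons made while sorting \<open>\<sigma>\<close>, read off from the output, have the outcome prescribed
  by \<open>R\<close>.
\<close>

definition LTR_compatible :: "(nat \<Rightarrow> nat \<Rightarrow> bool) \<Rightarrow> nat list \<Rightarrow> bool" where
  "LTR_compatible R \<sigma> \<longleftrightarrow> (\<forall>m\<in>set (LTR_maxima \<sigma>). \<forall>as bs. queuesort \<sigma> = as @ m # bs \<longrightarrow>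
     (\<forall>y\<in>set as. R y m) \<and> (bs \<noteq> [] \<longrightarrow> R m (hd bs)))"


lemma append_eq_append_ConsE:
  assumes "us @ vs = as @ m # bs" "m \<notin> set us"
  obtains cs where "as = us @ cs" "vs = cs @ m # bs"
  using assms by (auto simp: append_eq_append_conv2 append_eq_Cons_conv Cons_eq_append_conv)

lemma takeWhile_dropWhile_append:
  assumes "\<forall>x\<in>set as. P x" "bs \<noteq> [] \<Longrightarrow> \<not> P (hd bs)"
  shows "takeWhile P (as @ bs) = as" "dropWhile P (as @ bs) = bs"
  using assms by (induction as) (auto, (cases bs; simp)+)

lemma hd_in_LTR_maxima: "\<lbrakk>distinct xs; xs \<noteq> []\<rbrakk> \<Longrightarrow> hd xs \<in> set (LTR_maxima xs)"
  by (cases xs) (auto simp: LTR_maxima_Cons)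

lemma hd_le_LTR_maxima: "m \<in> set (LTR_maxima xs) \<Longrightarrow> hd xs \<le> m"
proof -
  have "hd xs \<le> xs ! (i - 1)" if "i \<in> LTR xs" for i
  proof (cases "i = 1")
    case False
    then have "xs ! (1 - 1) < xs ! (i - 1)" using that unfolding LTR_def by fastforce
    then show ?thesis using that by (cases xs) (auto simp: LTR_def)
  qed (use that in \<open>cases xs; auto simp: LTR_def\<close>)
  then show "m \<in> set (LTR_maxima xs) \<Longrightarrow> hd xs \<le> m"
    by (auto simp: LTR_maxima_def)
qed

text \<open>One step of the recursion, packaged for the inductions below: \<open>m\<close> passes
  the block \<open>ps\<close>, then the initial run \<open>ys\<close> of the sorted remainder, and
  stops before the first larger entry.\<close>

lemma queuesort_ConsE:
  assumes "distinct (m # xs)"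
  obtains ps rs ys zs where "xs = ps @ rs" "queuesort rs = ys @ zs"
    "queuesort (m # xs) = (ps @ ys) @ m # zs"
    "LTR_maxima (m # xs) = m # LTR_maxima rs"
    "\<forall>y\<in>set (ps @ ys). y < m" "zs \<noteq> [] \<Longrightarrow> m < hd zs"
    "\<forall>m'\<in>set (LTR_maxima rs). m < m'"
proof -
  define ps where "ps = takeWhile (\<lambda>x. x < m) xs"
  define rs where "rs = dropWhile (\<lambda>x. x < m) xs"
  define ys where "ys = takeWhile (\<lambda>x. x < m) (queuesort rs)"
  define zs where "zs = dropWhile (\<lambda>x. x < m) (queuesort rs)"
  have xs: "xs = ps @ rs" by (simp add: ps_def rs_def)
  have ps: "\<forall>x\<in>set ps. x < m" and ys: "\<forall>y\<in>set ys. y < m"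
    by (auto simp: ps_def ys_def dest: set_takeWhileD)
  show thesis
  proof
    show "xs = ps @ rs" by (fact xs)
    show "queuesort rs = ys @ zs" by (simp add: ys_def zs_def)
    show "queuesort (m # xs) = (ps @ ys) @ m # zs"
      unfolding queuesort_Cons[OF assms] ps_def[symmetric] rs_def[symmetric] bubble_Cons_same
      using ps by (simp add: ys_def zs_def)
    show "LTR_maxima (m # xs) = m # LTR_maxima rs"
      using assms by (simp add: LTR_maxima_Cons rs_def)
    show "\<forall>y\<in>set (ps @ ys). y < m" using ps ys by auto
    show "zs \<noteq> [] \<Longrightarrow> m < hd zs"
      using assms unfolding zs_def by (intro hd_dropWhile_less) (auto simp: xs)
    show "\<forall>m'\<in>set (LTR_maxima rs). m < m'"
    proof
      fix m' assume m': "m' \<in> set (LTR_maxima rs)"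
      then have "rs \<noteq> []" using set_LTR_maxima_subset by fastforce
      then have "m < hd rs" using assms hd_dropWhile_less[of m xs] by (simp add: rs_def)
      then show "m < m'" using hd_le_LTR_maxima[OF m'] by simp
    qed
  qed
qed

text \<open>Induction along \<open>queuesort_ConsE\<close>: \<open>m\<close> stops exactly between
  smaller entries and a larger one, and for later maxima the step only adds smaller entries on the
  left.\<close>

lemma LTR_compatible_less: "distinct \<sigma> \<Longrightarrow> LTR_compatible (<) \<sigma>"
proof (induction \<sigma> rule: length_induct)
  case (1 \<sigma>)
  show ?case
  proof (cases \<sigma>)
    case Nil
    then show ?thesis by (simp add: LTR_compatible_def LTR_maxima_def LTR_def)
  next
    case (Cons m xs)
    then have "distinct (m # xs)" using 1 by simp
    then obtain ps rs ys zs where d: "xs = ps @ rs" "queuesort rs = ys @ zs"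
      "queuesort (m # xs) = (ps @ ys) @ m # zs" "LTR_maxima (m # xs) = m # LTR_maxima rs"
      "\<forall>y\<in>set (ps @ ys). y < m" "zs \<noteq> [] \<Longrightarrow> m < hd zs"
      "\<forall>m'\<in>set (LTR_maxima rs). m < m'"
      by (rule queuesort_ConsE) blast
    have IH: "LTR_compatible (<) rs" using 1 Cons d(1) by simp
    have dist: "distinct ((ps @ ys) @ m # zs)"
      using \<open>distinct (m # xs)\<close> d(3) distinct_queuesort by metis
    show ?thesis
      unfolding LTR_compatible_def Cons d(3,4)
    proof (intro ballI allI impI)
      fix m' as bs
      assume m': "m' \<in> set (m # LTR_maxima rs)" and split: "(ps @ ys) @ m # zs = as @ m' # bs"
      show "(\<forall>y\<in>set as. y < m') \<and> (bs \<noteq> [] \<longrightarrow> m' < hd bs)"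
      proof (cases "m' = m")
        case True
        have "m \<notin> set (ps @ ys)" "m \<notin> set zs" using dist by auto
        \<comment> \<open>The entries are distinct, so there is only one way to split at
          \<open>m\<close>.\<close>
        then have "ps @ ys = as \<and> zs = bs"
          using split append_Cons_eq_iff[of m "ps @ ys" zs as bs] unfolding True by blast
        then show ?thesis using d True by auto
      next
        case False
        then have M: "m' \<in> set (LTR_maxima rs)" "m < m'" using m' d by auto
        \<comment> \<open>The output up to \<open>m\<close> has no entry above \<open>m\<close>, so
          \<open>m'\<close> lies in \<open>zs\<close> and keeps the right neighbour it has in the
          sorted \<open>rs\<close>.\<close>
        then have "m' \<notin> set (ps @ ys)" using d(5) less_asym by blast
        with False have "m' \<notin> set ((ps @ ys) @ [m])" by simp
        then obtain cs where cs: "as = ((ps @ ys) @ [m]) @ cs" "zs = cs @ m' # bs"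
          using append_eq_append_ConsE[of "(ps @ ys) @ [m]" zs as m' bs] split by auto
        have "queuesort rs = (ys @ cs) @ m' # bs" using d(2) cs(2) by simp
        then have "(\<forall>y\<in>set (ys @ cs). y < m') \<and> (bs \<noteq> [] \<longrightarrow> m' < hd bs)"
          using IH M(1) unfolding LTR_compatible_def by blast
        moreover have "\<forall>y\<in>set (ps @ ys). y < m'" using M(2) d(5) less_trans by blast
        ultimately show ?thesis using cs(1) M(2) by auto
      qed
    qed
  qed
qed

section \<open>Relabelling\<close>

text \<open>Compatibility makes \<open>f\<close> preserve the comparisons that decide where the
  recursion cuts its lists, so each \<open>takeWhile\<close> and \<open>dropWhile\<close> commutes
  with \<open>map f\<close>.\<close>

lemma queuesort_map:
  assumes "distinct \<sigma>" "inj_on f (set \<sigma>)" "LTR_compatible (\<lambda>x y. f x < f y) \<sigma>"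
  shows "queuesort (map f \<sigma>) = map f (queuesort \<sigma>)"
  using assms
proof (induction \<sigma> rule: length_induct)
  case (1 \<sigma>)
  show ?case
  proof (cases \<sigma>)
    case Nil
    then show ?thesis by (simp add: queuesort_def LTR_maxima_def LTR_def)
  next
    case (Cons m xs)
    then have dist: "distinct (m # xs)" using 1 by simp
    then obtain ps rs ys zs where d: "xs = ps @ rs" "queuesort rs = ys @ zs"
      "queuesort (m # xs) = (ps @ ys) @ m # zs" "LTR_maxima (m # xs) = m # LTR_maxima rs"
      "\<forall>y\<in>set (ps @ ys). y < m" "\<forall>m'\<in>set (LTR_maxima rs). m < m'"
      by (rule queuesort_ConsE) blast
    have compat: "(\<forall>y\<in>set as. f y < f m') \<and> (bs \<noteq> [] \<longrightarrow> f m' < f (hd bs))"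
      if "m' \<in> set (m # LTR_maxima rs)" "(ps @ ys) @ m # zs = as @ m' # bs" for m' as bs
      using 1(4) that unfolding LTR_compatible_def Cons d(3,4) by blast
    \<comment> \<open>Extends a splitting of the sorted \<open>rs\<close> to one of the whole output
      with the same right part, so that compatibility passes from \<open>\<sigma>\<close> to
      \<open>rs\<close>.\<close>
    have later: "\<exists>cs. as = ys @ cs \<and> (ps @ ys) @ m # zs = (((ps @ ys) @ [m]) @ cs) @ m' # bs"
      if "m' \<in> set (LTR_maxima rs)" "ys @ zs = as @ m' # bs" for m' as bs
    proof -
      have "m' \<notin> set (ps @ ys)" using that(1) d(5,6) less_asym by blast
      then have "m' \<notin> set ys" by simp
      then show ?thesis using that(2) append_eq_append_ConsE[of ys zs as m' bs] by auto
    qed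
    have less: "\<forall>y\<in>set (ps @ ys). f y < f m" "zs \<noteq> [] \<longrightarrow> f m < f (hd zs)"
      using compat[of m "ps @ ys" zs] by auto
    \<comment> \<open>Needed to cut \<open>map f xs\<close> right after \<open>map f ps\<close>. The
      entry \<open>hd rs\<close> is itself an LTR maximum of \<open>\<sigma>\<close> and ends up to
      the right of \<open>m\<close>, so \<open>compat\<close> at \<open>hd rs\<close> covers this
      comparison.\<close>
    have rs: "f m < f (hd rs)" if "rs \<noteq> []"
    proof -
      have M: "hd rs \<in> set (LTR_maxima rs)"
        using that dist d(1) by (intro hd_in_LTR_maxima) auto
      have "hd rs \<in> set (ys @ zs)"
        using that unfolding d(2)[symmetric] set_queuesort by (rule hd_in_set)
      then obtain as bs where "ys @ zs = as @ hd rs # bs"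
        by (meson split_list)
      with M obtain cs where "(ps @ ys) @ m # zs = (((ps @ ys) @ [m]) @ cs) @ hd rs # bs"
        using later by blast
      with M compat[of "hd rs" "((ps @ ys) @ [m]) @ cs" bs] show ?thesis by simp
    qed
    have "LTR_compatible (\<lambda>x y. f x < f y) rs"
      unfolding LTR_compatible_def d(2)
    proof (intro ballI allI impI)
      fix m' as bs assume *: "m' \<in> set (LTR_maxima rs)" "ys @ zs = as @ m' # bs"
      then obtain cs where "as = ys @ cs"
        "(ps @ ys) @ m # zs = (((ps @ ys) @ [m]) @ cs) @ m' # bs"
        using later by blast
      then show "(\<forall>y\<in>set as. f y < f m') \<and> (bs \<noteq> [] \<longrightarrow> f m' < f (hd bs))"
        using compat[of m' "((ps @ ys) @ [m]) @ cs" bs] *(1) by auto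
    qed
    moreover have "distinct rs" "inj_on f (set rs)" "length rs < length \<sigma>"
      using 1(2,3) Cons d(1) by (auto intro: inj_on_subset)
    ultimately have "queuesort (map f rs) = map f (queuesort rs)"
      using 1(1) by blast
    then have IH: "queuesort (map f rs) = map f ys @ map f zs"
      using d(2) by simp
    have "distinct (map f (m # xs))" using 1(2,3) Cons by (simp add: distinct_map)
    then have dist': "distinct (f m # map f xs)" by simp
    have P: "takeWhile (\<lambda>x. x < f m) (map f xs) = map f ps"
      "dropWhile (\<lambda>x. x < f m) (map f xs) = map f rs"
      unfolding d(1) map_append
      by (rule takeWhile_dropWhile_append; use less rs in \<open>auto simp: hd_map\<close>)+
    have Q: "takeWhile (\<lambda>x. x < f m) (map f (ps @ ys) @ map f zs) = map f (ps @ ys)"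
      "dropWhile (\<lambda>x. x < f m) (map f (ps @ ys) @ map f zs) = map f zs"
      by (rule takeWhile_dropWhile_append; use less in \<open>auto simp: hd_map\<close>)+
    have "queuesort (map f (m # xs)) = bubble (f m) (f m # map f (ps @ ys) @ map f zs)"
      using queuesort_Cons[OF dist'] by (simp add: P IH)
    also have "\<dots> = map f (queuesort (m # xs))"
      unfolding bubble_Cons_same Q d(3) by simp
    finally show ?thesis by (simp only: Cons)
  qed
qed

text \<open>By \<open>LTR_compatible_less\<close>, \<open>m\<close> and its right neighbour stand at
  LTR positions of the output; the inclusion carries these over to the relabelled output.\<close>

lemma LTR_compatible_map:
  assumes "distinct \<sigma>" "LTR (queuesort \<sigma>) \<subseteq> LTR (map f (queuesort \<sigma>))"
  shows "LTR_compatible (\<lambda>x y. f x < f y) \<sigma>"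
  unfolding LTR_compatible_def
proof (intro ballI allI impI)
  fix m as bs
  assume m: "m \<in> set (LTR_maxima \<sigma>)" and split: "queuesort \<sigma> = as @ m # bs"
  have less: "\<forall>y\<in>set as. y < m" "bs \<noteq> [] \<longrightarrow> m < hd bs"
    using LTR_compatible_less[OF assms(1)] m split unfolding LTR_compatible_def by blast+
  have transfer: "\<forall>y\<in>set us. f y < f v"
    if "queuesort \<sigma> = us @ v # ws" "\<forall>y\<in>set us. y < v" for us v ws
  proof -
    have "Suc (length us) \<in> LTR (queuesort \<sigma>)"
      using that by (simp add: mem_LTR_append)
    then have "Suc (length (map f us)) \<in> LTR (map f us @ f v # map f ws)"
      using assms(2) that(1) by auto
    then show ?thesis unfolding mem_LTR_append by simp
  qed
  \<comment> \<open>The neighbour \<open>hd bs\<close> exceeds \<open>m\<close>, hence all of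
    \<open>as @ [m]\<close>, and \<open>m\<close> is in this prefix.\<close>
  have "f m < f (hd bs)" if "bs \<noteq> []"
    using transfer[of "as @ [m]" "hd bs" "tl bs"] split less that by fastforce
  then show "(\<forall>y\<in>set as. f y < f m) \<and> (bs \<noteq> [] \<longrightarrow> f m < f (hd bs))"
    using transfer split less(1) by blast
qed

theorem theorem4p4:
  fixes n :: nat and \<rho> \<pi> :: "nat list"
  assumes "\<rho> \<in> permutations_of_set {1..n}"
    and "\<pi> \<in> permutations_of_set {1..n}"
    and "LTR \<rho> \<subseteq> LTR \<pi>"
  shows "card (queuesort_preimage n \<rho>) \<le> card (queuesort_preimage n \<pi>)"
proof -
  have \<rho>: "set \<rho> = {1..n}" "distinct \<rho>" and \<pi>: "set \<pi> = {1..n}" "distinct \<pi>"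
    using assms(1,2) by (auto simp: permutations_of_set_def)
  then have len: "length \<rho> = length \<pi>" by (metis distinct_card)
  \<comment> \<open>Sends each entry of \<open>\<rho>\<close> to the entry of \<open>\<pi>\<close>
    at the same position; outside \<open>set \<rho>\<close> its value is the unspecified
    \<open>the None\<close>, so injectivity is stated on \<open>{1..n}\<close> only.\<close>
  define f where "f x = the (map_of (zip \<rho> \<pi>) x)" for x
  have map: "map f \<rho> = \<pi>"
    using len \<rho>(2) by (intro nth_equalityI) (auto simp: f_def map_of_zip_nth)
  have inj: "inj_on f {1..n}"
    using \<pi>(2) \<rho> by (metis map distinct_map)
  show ?thesis
  proof (rule card_inj_on_le)
    show "inj_on (map f) (queuesort_preimage n \<rho>)"
      using inj by (intro inj_on_mapI, elim inj_on_subset)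
        (auto simp: queuesort_preimage_def permutations_of_set_def)
    show "map f ` queuesort_preimage n \<rho> \<subseteq> queuesort_preimage n \<pi>"
    proof (intro image_subsetI)
      fix \<sigma> assume "\<sigma> \<in> queuesort_preimage n \<rho>"
      then have \<sigma>: "set \<sigma> = {1..n}" "distinct \<sigma>" "queuesort \<sigma> = \<rho>"
        by (auto simp: queuesort_preimage_def permutations_of_set_def)
      have "LTR_compatible (\<lambda>x y. f x < f y) \<sigma>"
        using LTR_compatible_map \<sigma> map assms(3) by metis
      then have "queuesort (map f \<sigma>) = \<pi>"
        using queuesort_map \<sigma> inj map by metis
      moreover have "f ` {1..n} = {1..n}"
        using map \<rho>(1) \<pi>(1) by (metis set_map)
      ultimately show "map f \<sigma> \<in> queuesort_preimage n \<pi>"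
        using \<sigma> inj by (simp add: queuesort_preimage_def permutations_of_set_def distinct_map)
    qed
    show "finite (queuesort_preimage n \<pi>)"
      by (simp add: queuesort_preimage_def)
  qed
qed

end
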